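(* Let $\mathbb{F}_q$ be a finite field of characteristic $2$ with $q>4$ elements, and let $D=\mathbb{F}_q^*$ or $D=\mathbb{F}_q^*\setminus\{1\}$. Put $k=q-4$. Then for every $a\in\mathbb{F}_q$ with $a\ne 0$ and every polynomial $h(x)\in\mathbb{F}_q[x]$ of degree at most $k-1$, the word defined by the polynomial $ax^{q-3}+h(x)$ is a deep hole of the Reed-Solomon code $GRS_{q-4}(\mathbb{F}_q,D)$.
   Context: Let $D=\{x_1,\dots,x_n\}\subseteq\mathbb{F}_q$ with $x_1,\dots,x_n$ distinct and $1\le k\le n$. The generalized Reed-Solomon code is $GRS_k(\mathbb{F}_q,D)=\{(g(x_1),\dots,g(x_n))\in\mathbb{F}_q^n : g\in\mathbb{F}_q[x],\ \deg g\le k-1\}$ (the zero polynomial is allowed). For $f\in\mathbb{F}_q[x]$, the word defined by $f$ is $u_f=(f(x_1),\dots,f(x_n))$. The Hamming distance is $d(u,v)=\#\{i: u_i\ne v_i\}$ and the error distance is $d(u,C)=\min\{d(u,v): v\in C\}$. A word $u\in\mathbb{F}_q^n$ is a deep hole of $C=GRS_k(\mathbb{F}_q,D)$ if $d(u,C)=n-k$. Here $\mathbb{F}_q^*=\mathbb{F}_q\setminus\{0\}$. *)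

theory Defs
  imports
    "HOL-Computational_Algebra.Computational_Algebra"
    "HOL-Library.Cardinality"
begin

text \<open>
  The evaluation set \<open>D = {x\<^sub>1, \<dots>, x\<^sub>n}\<close> is given by a list \<open>xs\<close> of its elements (distinct in all uses),
  and a word in \<open>F\<^sup>n\<close> is a list of length \<open>n = length xs\<close>.
\<close>

definition word_of :: "'a::comm_semiring_0 list \<Rightarrow> 'a poly \<Rightarrow> 'a list" where
  "word_of xs f = map (poly f) xs"

text \<open>
  Meant for \<open>k \<ge> 1\<close>. Since \<^term>\<open>degree 0 = 0\<close>, the zero polynomial is included.
\<close>

definition GRS :: "nat \<Rightarrow> 'a::comm_semiring_0 list \<Rightarrow> 'a list set" where
  "GRS k xs = {word_of xs g | g. degree g \<le> k - 1}"

text \<open>Meant for words of equal length.\<close>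

definition hamming_dist :: "'a list \<Rightarrow> 'a list \<Rightarrow> nat" where
  "hamming_dist u v = card {i. i < length u \<and> u ! i \<noteq> v ! i}"

text \<open>
  The set of distances is finite, being bounded by \<^term>\<open>length u\<close>, so the minimum exists
  whenever \<open>C\<close> is nonempty.
\<close>

definition error_dist :: "'a list \<Rightarrow> 'a list set \<Rightarrow> nat" where
  "error_dist u C = Min (hamming_dist u ` C)"

text \<open>Meant for \<open>1 \<le> k \<le> length xs\<close>, so that the subtraction does not truncate.\<close>

definition deep_hole :: "nat \<Rightarrow> 'a::comm_semiring_0 list \<Rightarrow> 'a list \<Rightarrow> bool" where
  "deep_hole k xs u \<longleftrightarrow>
     length u = length xs \<and> error_dist u (GRS k xs) = length xs - k"

end

theory Submission
  imports Defs
begin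

text \<open>
  A codeword agreeing with \<open>a x\<^sup>q\<^sup>-\<^sup>3 + h\<close> in more than \<open>q - 4\<close> places yields a polynomial
  \<open>a x\<^sup>q\<^sup>-\<^sup>3 + (terms of degree at most q - 5)\<close> that splits with \<open>q - 3\<close> distinct roots in \<open>D\<close>.
  By Vieta these roots sum to \<open>0\<close>, as do all elements of the field, so the three
  remaining elements \<open>0, b, c\<close> satisfy \<open>b + c = 0\<close>, that is, \<open>b = c\<close> in characteristic \<open>2\<close>.
  Conversely, interpolation on \<open>q - 4\<close> points of \<open>D\<close> gives a codeword with that many agreements.
\<close>

text \<open>Distinctness makes \<open>(!) xs\<close> injective, so counting disagreeing indices
  amounts to counting disagreeing points of \<open>set xs\<close>.\<close>

lemma hamming_dist_word_of:
  assumes "distinct xs"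
  shows "hamming_dist (word_of xs f) (word_of xs g)
    = length xs - card {x \<in> set xs. poly f x = poly g x}"
proof -
  let ?A = "{x \<in> set xs. poly f x = poly g x}"
  let ?I = "{i. i < length xs \<and> poly f (xs ! i) \<noteq> poly g (xs ! i)}"
  have "hamming_dist (word_of xs f) (word_of xs g) = card ?I"
    unfolding hamming_dist_def word_of_def by (rule arg_cong[of _ _ card]) auto
  also have "\<dots> = card ((!) xs ` ?I)"
    by (rule card_image[symmetric]) (use assms in \<open>auto simp: inj_on_def nth_eq_iff_index_eq\<close>)
  also have "(!) xs ` ?I = set xs - ?A"
    by (auto simp: in_set_conv_nth)
  also have "card \<dots> = length xs - card ?A"
    using assms by (subst card_Diff_subset) (auto simp: distinct_card)
  finally show ?thesis .
qed

lemma degree_prod_root_factors: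
  fixes S :: "'a::idom set"
  shows "degree (\<Prod>s\<in>S. [:-s, 1:]) = card S"
  by (subst degree_prod_eq_sum_degree) auto

lemma lead_coeff_prod_root_factors:
  fixes S :: "'a::idom set"
  shows "coeff (\<Prod>s\<in>S. [:-s, 1:]) (card S) = 1"
  using lead_coeff_prod[of "\<lambda>s. [:-s, 1:]" S] by (simp add: degree_prod_root_factors)

lemma poly_prod_root_factors_eq_0:
  fixes S :: "'a::idom set"
  assumes "finite S" "x \<in> S"
  shows "poly (\<Prod>s\<in>S. [:-s, 1:]) x = 0"
  using assms by (auto simp: poly_prod)

text \<open>Vieta by induction: multiplying by x - t shifts the old subleading coefficient up by one
  and subtracts t times the leading coefficient 1.\<close>

lemma coeff_prod_root_factors_subleading:
  fixes S :: "'a::idom set"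
  assumes "finite S" "card S = Suc m"
  shows "coeff (\<Prod>s\<in>S. [:-s, 1:]) m = - \<Sum>S"
  using assms
proof (induction S arbitrary: m rule: finite_induct)
  case (insert t S)
  then have m: "card S = m" by simp
  have "(\<Prod>s\<in>insert t S. [:-s, 1:])
      = pCons 0 (\<Prod>s\<in>S. [:-s, 1:]) - smult t (\<Prod>s\<in>S. [:-s, 1:])"
    using insert.hyps by (simp add: mult_pCons_left)
  then have eq: "coeff (\<Prod>s\<in>insert t S. [:-s, 1:]) m
      = coeff (pCons 0 (\<Prod>s\<in>S. [:-s, 1:])) m - t"
    using lead_coeff_prod_root_factors[of S] m by simp
  show ?case
  proof (cases m)
    \<comment> \<open>Here \<open>S\<close> is empty and has no subleading coefficient; the
      \<open>0\<close> of \<open>pCons\<close> stands in for it.\<close>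
    case 0
    then show ?thesis using eq m insert.hyps by simp
  next
    case (Suc j)
    then show ?thesis using eq m insert.hyps insert.IH[of j] by simp
  qed
qed simp

text \<open>Subtracting \<open>coeff p (Suc m)\<close> times the product of the root factors cancels
  the top term and leaves degree at most m with m + 1 roots, hence 0. Vieta then applies to
  \<open>p\<close>.\<close>

lemma split_poly_sum_roots_eq_0:
  fixes p :: "'a::field poly"
  assumes "finite S" "card S = Suc m" "degree p \<le> Suc m" "coeff p (Suc m) \<noteq> 0" "coeff p m = 0"
    and roots: "\<And>s. s \<in> S \<Longrightarrow> poly p s = 0"
  shows "\<Sum>S = 0"
proof -
  let ?P = "\<Prod>s\<in>S. [:-s, 1:]" and ?a = "coeff p (Suc m)"
  have "p = smult ?a ?P"
  proof (rule poly_eqI_degree_lead_coeff[where A = S and n = "Suc m"])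
    show "coeff p (Suc m) = coeff (smult ?a ?P) (Suc m)"
      using lead_coeff_prod_root_factors[of S] assms(2) by simp
  qed (use assms in \<open>auto simp: degree_prod_root_factors poly_prod_root_factors_eq_0\<close>)
  then have "coeff p m = ?a * - \<Sum>S"
    using coeff_prod_root_factors_subleading[OF assms(1,2)] by (metis coeff_smult)
  then show ?thesis using assms by simp
qed

text \<open>Multiplication by some c other than 0 and 1 permutes the field, so the sum is fixed by c
  and must vanish.\<close>

lemma sum_UNIV_field:
  assumes "CARD('a::{finite,field}) > 2"
  shows "\<Sum>(UNIV :: 'a set) = 0"
proof -
  have "\<not> UNIV \<subseteq> {0, 1 :: 'a}"
    using assms card_mono[of "{0, 1 :: 'a}" UNIV] by auto
  then obtain c :: 'a where c: "c \<noteq> 0" "c \<noteq> 1" by blast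
  have "bij ((*) c)"
    by (rule bij_betw_byWitness[where f' = "\<lambda>x. x / c"]) (use c in auto)
  then have "\<Sum>(UNIV :: 'a set) = (\<Sum>x\<in>UNIV. c * x)"
    by (simp add: sum.reindex_bij_betw[of "(*) c" UNIV UNIV "\<lambda>x. x"])
  then have "(1 - c) * \<Sum>(UNIV :: 'a set) = 0"
    by (simp add: sum_distrib_left[symmetric] left_diff_distrib)
  then show ?thesis using c by simp
qed

lemma sum_nonzero_if_card_complement_3:
  fixes S :: "'a::{finite,field} set"
  assumes "CARD('a) > 2" "CHAR('a) = 2" "card S = CARD('a) - 3" "0 \<notin> S"
  shows "\<Sum>S \<noteq> 0"
proof
  assume "\<Sum>S = 0"
  then have "\<Sum>(- S) = 0"
    using sum_UNIV_field[OF assms(1)] sum.subset_diff[of S UNIV "\<lambda>x. x"]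
    by (simp add: Compl_eq_Diff_UNIV)
  \<comment> \<open>The complement of \<open>S\<close> has three elements, one of which is
    0.\<close>
  moreover have "card (- S - {0}) = 2"
    using assms by (simp add: card_Diff_singleton Compl_eq_Diff_UNIV card_Diff_subset)
  then obtain b c where bc: "- S - {0} = {b, c}" "b \<noteq> c" by (meson card_2_iff)
  have "\<Sum>(- S) = \<Sum>(- S - {0})" by (rule sum.mono_neutral_right) auto
  ultimately have "b = - c" using bc by (simp add: eq_neg_iff_add_eq_0)
  then show False using bc uminus_CHAR_2[OF assms(2)] by simp
qed

text \<open>The interpolant is the remainder of \<open>f\<close> modulo the product of the root
  factors of \<open>T\<close>, which vanishes on \<open>T\<close>.\<close>

lemma exists_interpolating_poly:
  fixes f :: "'a::field poly"
  assumes "finite T" "T \<noteq> {}"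
  shows "\<exists>g. degree g \<le> card T - 1 \<and> (\<forall>t\<in>T. poly f t = poly g t)"
proof (intro exI conjI ballI)
  let ?P = "\<Prod>t\<in>T. [:-t, 1:]"
  have "card T > 0" using assms by (simp add: card_gt_0_iff)
  have "?P \<noteq> 0" using assms(1) by simp
  then show "degree (f mod ?P) \<le> card T - 1"
    using degree_mod_less[of ?P f] \<open>card T > 0\<close> by (auto simp: degree_prod_root_factors)
  fix t assume "t \<in> T"
  then have "poly (f div ?P * ?P + f mod ?P) t = poly (f mod ?P) t"
    using poly_prod_root_factors_eq_0[OF assms(1)] by simp
  then show "poly f t = poly (f mod ?P) t" by (simp only: div_mult_mod_eq)
qed

theorem theorem3p2:
  fixes D :: "'a::{finite,field} set" and xs :: "'a list" and q k :: nat
    and a :: 'a and h :: "'a poly"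
  assumes "q = CARD('a)" and "CHAR('a) = 2" and "q > 4"
    and "D = UNIV - {0} \<or> D = UNIV - {0} - {1}"
    and "distinct xs" and "set xs = D"
    and "k = q - 4"
    and "a \<noteq> 0" and "degree h \<le> k - 1"
  shows "deep_hole k xs (word_of xs (monom a (q - 3) + h))"
proof -
  let ?f = "monom a (q - 3) + h"
  let ?E = "\<lambda>g. {x \<in> set xs. poly ?f x = poly g x}"
  have "k \<ge> 1" using assms(3,7) by simp
  \<comment> \<open>The smaller choice of \<open>D\<close> has q - 2 elements, so
    \<open>length xs - k\<close> does not truncate.\<close>
  have "card D \<ge> q - 2"
    using assms(4) unfolding assms(1) by (elim disjE) (simp_all add: card_Diff_singleton)
  moreover have "length xs = card D"
    using distinct_card[OF assms(5)] assms(6) by simp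
  ultimately have len: "length xs \<ge> k" using assms(7) by linarith
  have D: "0 \<notin> set xs" using assms(4,6) by blast
  have upper: "card (?E g) \<le> k" if g: "degree g \<le> k - 1" for g
  proof (rule ccontr)
    assume "\<not> card (?E g) \<le> k"
    then obtain S where S: "S \<subseteq> ?E g" "card S = Suc k"
      using obtain_subset_with_card_n[of "Suc k" "?E g"] by (auto simp: not_le Suc_le_eq)
    \<comment> \<open>Hence \<open>?f - g\<close> has coefficient a at k + 1 and 0 at k, the gap
      that forces the roots to sum to 0.\<close>
    have [simp]: "coeff h i = 0" "coeff g i = 0" if "i \<ge> k" for i
      using that g assms(9) \<open>k \<ge> 1\<close> by (auto intro!: coeff_eq_0)
    have q: "q - 3 = Suc k" using assms(3,7) by simp
    have "\<Sum>S = 0"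
    proof (rule split_poly_sum_roots_eq_0)
      show "degree (?f - g) \<le> Suc k"
        by (rule degree_le) (auto simp: q)
    qed (use S assms(8) in \<open>auto simp: q\<close>)
    moreover have "\<Sum>S \<noteq> 0"
      by (rule sum_nonzero_if_card_complement_3) (use S D q assms(1-3) in auto)
    ultimately show False by simp
  qed
  obtain T where T: "T \<subseteq> set xs" "card T = k"
    using len distinct_card[OF assms(5)] obtain_subset_with_card_n[of k "set xs"] by metis
  then have "T \<noteq> {}" using \<open>k \<ge> 1\<close> by auto
  then obtain g where g: "degree g \<le> k - 1" "\<forall>t\<in>T. poly ?f t = poly g t"
    using exists_interpolating_poly[of T ?f] T by auto
  have "k \<le> card (?E g)"
    using card_mono[of "?E g" T] g T by auto
  then have "card (?E g) = k" using upper g by (simp add: le_antisym)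
  then have "length xs - k = hamming_dist (word_of xs ?f) (word_of xs g)"
    by (simp add: hamming_dist_word_of assms(5))
  moreover have "word_of xs g \<in> GRS k xs" using g by (auto simp: GRS_def)
  ultimately have attained: "length xs - k \<in> hamming_dist (word_of xs ?f) ` GRS k xs"
    by blast
  \<comment> \<open>The upper bound serves to make the set of distances finite, as
    \<open>Min\<close> requires.\<close>
  have lower: "length xs - k \<le> d \<and> d \<le> length xs"
    if "d \<in> hamming_dist (word_of xs ?f) ` GRS k xs" for d
  proof -
    obtain g where g: "degree g \<le> k - 1" "d = hamming_dist (word_of xs ?f) (word_of xs g)"
      using \<open>d \<in> _\<close> unfolding GRS_def by blast
    then have "d = length xs - card (?E g)"
      by (simp only: hamming_dist_word_of[OF assms(5)])
    then show ?thesis using upper[OF g(1)] by linarith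
  qed
  then have "hamming_dist (word_of xs ?f) ` GRS k xs \<subseteq> {..length xs}" by blast
  then have "finite (hamming_dist (word_of xs ?f) ` GRS k xs)"
    using finite_subset by blast
  then have "error_dist (word_of xs ?f) (GRS k xs) = length xs - k"
    unfolding error_dist_def by (rule Min_eqI) (use attained lower in blast)+
  then show ?thesis by (simp add: deep_hole_def word_of_def)
qed

end
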